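(* Let $\boldsymbol X=(X_1,\dots,X_d)=A\times_{\max}\boldsymbol Z$ be a recursive max-linear (ML) vector on a well-ordered DAG satisfying assumptions (A1)-(A3) of the context, so that $A=(a_{ij})$ is upper triangular. For nonempty $\boldsymbol h\subseteq\{1,\dots,d\}$ let $M_{\boldsymbol h}=\max_{i\in\boldsymbol h}X_i$, with squared scaling $\sigma^2_{M_{\boldsymbol h}}$. Define the column vectors in $\mathbb R_+^{d(d+1)/2}$ $$S_M=(\sigma^2_{M_{1,2,\dots,d}},\sigma^2_{M_{1,3,\dots,d}},\dots,\sigma^2_{M_{1,d}},\sigma_1^2,\ \sigma^2_{M_{2,3,\dots,d}},\sigma^2_{M_{2,4,\dots,d}},\dots,\sigma^2_{M_{2,d}},\sigma_2^2,\ \dots,\ \sigma^2_{M_{d-1,d}},\sigma^2_{d-1},\ \sigma_d^2)^\top,$$ $$A^2=(a_{11}^2,\dots,a_{1d}^2,\ a_{22}^2,\dots,a_{2d}^2,\ \dots,\ a_{d-1,d-1}^2,a_{d-1,d}^2,\ a_{dd}^2)^\top .$$ For $1\le i\le j\le d$ put $l_{ij}=(j-d)+\sum_{k=0}^{i-1}(d-k)$ (the position of $a_{ij}^2$ in the vector $A^2$). Then $$A^2=T\,S_M,$$ where $T=(t_{uv})\in\mathbb R^{k\times k}$, $k=d(d+1)/2$, has the following entries: - row $l_{ii}$, for $i=1,\dots,d-1$: $t_{l_{ii},l_{ii}}=1$, $t_{l_{ii},l_{i+1,i+1}}=-1$; - row $l_{dd}$: $t_{l_{dd},l_{dd}}=1$;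 - row $l_{ij}$, for $i<j\le d-1$: $t_{l_{ij},l_{ij}}=1$, $t_{l_{ij},l_{j+1,j+1}}=-1$, $t_{l_{ij},l_{i,j-1}}=-1$, $t_{l_{ij},l_{jj}}=1$; - row $l_{id}$, for $i=1,\dots,d-1$: $t_{l_{id},l_{id}}=1$, $t_{l_{id},l_{i,d-1}}=-1$, $t_{l_{id},l_{dd}}=1$; and all other entries of $T$ are $0$.
   Context: Recursive ML vector. Let $\mathcal D=(V,E)$ be a DAG with nodes $V=\{1,\dots,d\}$; $\mathrm{pa}(i)$ are the parents of $i$, $\mathrm{an}(i)$ the ancestors of $i$ (not including $i$), $\mathrm{An}(i)=\mathrm{an}(i)\cup\{i\}$. $\mathcal D$ is well-ordered if $i<j$ for all $i\in V$ and $j\in\mathrm{pa}(i)$. An innovations vector $\boldsymbol Z=(Z_1,\dots,Z_d)$ has independent, atom-free components with support $\mathbb R_+$. Given edge weights $c_{ik}>0$ for $k\in\mathrm{pa}(i)\cup\{i\}$, define $X_i=\bigvee_{k\in\mathrm{pa}(i)}c_{ik}X_k\vee c_{ii}Z_i$. For a path $p=[j\to k_1\to\cdots\to k_l=i]$ put $d(p)=c_{jj}c_{k_1j}\cdots c_{ik_{l-1}}$; let $a_{ij}=\max_p d(p)$ over all paths from $j$ to $i$ if $j\in\mathrm{an}(i)$, $a_{ii}=c_{ii}$, and $a_{ij}=0$ if $j\notin\mathrm{An}(i)$. Then $X_i=\bigvee_{j=1}^d a_{ij}Z_j$, written $\boldsymbol X=A\times_{\max}\boldsymbol Z$; $\boldsymbol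 X$ is called a recursive ML vector and $A=(a_{ij})$ its ML coefficient matrix. Regular variation. $\boldsymbol Y\in\mathbb R^d_+$ is in $RV^d_+(2)$ (with normalizing sequence $b_n=\sqrt n$ and the Euclidean norm) if, for $R=\|\boldsymbol Y\|_2$ and $\boldsymbol\omega=\boldsymbol Y/R$, $n\mathbb P[(R/\sqrt n,\boldsymbol\omega)\in\cdot]\to\nu_2\times H_{\boldsymbol Y}$ vaguely on $(0,\infty]\times\Theta_+^{d-1}$, where $d\nu_2(x)=2x^{-3}dx$, $\Theta_+^{d-1}=\{\boldsymbol\omega\in\mathbb R_+^d:\|\boldsymbol\omega\|_2=1\}$ and $H_{\boldsymbol Y}$ is a finite (spectral) measure. Scalings. For $Y\in RV^1_+(2)$ the squared scaling is $\sigma_Y^2=\lim_{n\to\infty}n\mathbb P(Y>\sqrt n)$; write $\sigma_i^2=\sigma_{X_i}^2$. Assumptions. (A1) $\boldsymbol Z\in RV^d_+(2)$ has independent and standardized components: $n\mathbb P(n^{-1/2}Z_i>x)\to x^{-2}$ for all $x>0$ and all $i$. (A2) The norm is the Euclidean norm. (A3) $A$ is standardized, i.e. $a_{ij}$ is replaced by $a_{ij}/(\sum_{k=1}^da_{ik}^2)^{1/2}$, so that $\sum_{k=1}^d a_{ik}^2=1$ for every $i$. *)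

theory Defs
  imports "HOL-Probability.Probability" "Jordan_Normal_Form.Matrix"
begin

section \<open>Directed acyclic graphs on $\{1,\dots,d\}$\<close>

text \<open>An edge relation \<open>E\<close> contains \<open>(j, i)\<close> iff there is an edge \<open>j \<rightarrow> i\<close>.\<close>

definition dag_on :: "nat \<Rightarrow> (nat \<times> nat) set \<Rightarrow> bool" where
  "dag_on d E \<longleftrightarrow> E \<subseteq> {1..d} \<times> {1..d} \<and> acyclic E"

definition parents :: "(nat \<times> nat) set \<Rightarrow> nat \<Rightarrow> nat set" where
  "parents E i = {j. (j, i) \<in> E}"

definition ancestors :: "(nat \<times> nat) set \<Rightarrow> nat \<Rightarrow> nat set" where
  "ancestors E i = {j. (j, i) \<in> E\<^sup>+}"

definition well_ordered_dag :: "nat \<Rightarrow> (nat \<times> nat) set \<Rightarrow> bool" where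
  "well_ordered_dag d E \<longleftrightarrow> dag_on d E \<and> (\<forall>i\<in>{1..d}. \<forall>j\<in>parents E i. i < j)"

text \<open>A path is the list of its nodes; it has at least one edge.\<close>

definition paths :: "(nat \<times> nat) set \<Rightarrow> nat \<Rightarrow> nat \<Rightarrow> nat list set" where
  "paths E j i =
     {p. 2 \<le> length p \<and> hd p = j \<and> last p = i \<and> successively (\<lambda>u v. (u, v) \<in> E) p}"


section \<open>Recursive max-linear vectors\<close>

text \<open>\<open>c i k\<close> is the weight of the edge \<open>k \<rightarrow> i\<close>, and \<open>c i i\<close> that of the innovation \<open>Z i\<close>.\<close>

definition positive_weights :: "nat \<Rightarrow> (nat \<times> nat) set \<Rightarrow> (nat \<Rightarrow> nat \<Rightarrow> real) \<Rightarrow> bool" where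
  "positive_weights d E c \<longleftrightarrow> (\<forall>i\<in>{1..d}. \<forall>k\<in>parents E i \<union> {i}. 0 < c i k)"

definition path_weight :: "(nat \<Rightarrow> nat \<Rightarrow> real) \<Rightarrow> nat list \<Rightarrow> real" where
  "path_weight c p = c (hd p) (hd p) * (\<Prod>r<length p - 1. c (p ! Suc r) (p ! r))"

definition ml_coeff :: "(nat \<times> nat) set \<Rightarrow> (nat \<Rightarrow> nat \<Rightarrow> real) \<Rightarrow> nat \<Rightarrow> nat \<Rightarrow> real" where
  "ml_coeff E c i j =
     (if j \<in> ancestors E i then Max (path_weight c ` paths E j i)
      else if j = i then c i i else 0)"

definition measure_support :: "'b::topological_space measure \<Rightarrow> 'b set" where
  "measure_support N = {x. \<forall>U. open U \<longrightarrow> x \<in> U \<longrightarrow> 0 < emeasure N U}"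

definition innovations :: "'a measure \<Rightarrow> nat \<Rightarrow> (nat \<Rightarrow> 'a \<Rightarrow> real) \<Rightarrow> bool" where
  "innovations M d Z \<longleftrightarrow>
     prob_space.indep_vars M (\<lambda>_. borel) Z {1..d} \<and>
     (\<forall>i\<in>{1..d}. (\<forall>x. measure M {w \<in> space M. Z i w = x} = 0) \<and>
                 measure_support (distr M borel (Z i)) = {0..})"

definition recursive_ML_vector ::
  "'a measure \<Rightarrow> nat \<Rightarrow> (nat \<times> nat) set \<Rightarrow> (nat \<Rightarrow> nat \<Rightarrow> real) \<Rightarrow>
   (nat \<Rightarrow> 'a \<Rightarrow> real) \<Rightarrow> (nat \<Rightarrow> 'a \<Rightarrow> real) \<Rightarrow> bool" where
  "recursive_ML_vector M d E c Z X \<longleftrightarrow>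
     (\<forall>i\<in>{1..d}. \<forall>w\<in>space M.
        X i w = Max (insert (c i i * Z i w) ((\<lambda>k. c i k * X k w) ` parents E i)))"

definition standardized :: "nat \<Rightarrow> (nat \<Rightarrow> nat \<Rightarrow> real) \<Rightarrow> bool" where
  "standardized d A \<longleftrightarrow> (\<forall>i\<in>{1..d}. (\<Sum>k\<in>{1..d}. (A i k)\<^sup>2) = 1)"


section \<open>Regular variation with index 2\<close>

text \<open>Vague convergence on a locally compact subspace \<open>S\<close>, tested against continuous functions
  with compact support in \<open>S\<close>.\<close>

definition vaguely_converges_on ::
  "'b::topological_space set \<Rightarrow> (nat \<Rightarrow> 'b measure) \<Rightarrow> 'b measure \<Rightarrow> bool" where
  "vaguely_converges_on S \<mu> \<mu>' \<longleftrightarrow>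
     (\<forall>f :: 'b \<Rightarrow> real.
        continuous_on S f \<and> (\<exists>K. compact K \<and> K \<subseteq> S \<and> (\<forall>x\<in>S - K. f x = 0)) \<longrightarrow>
        (\<lambda>n. LINT x:S|\<mu> n. f x) \<longlonglongrightarrow> (LINT x:S|\<mu>'. f x))"

text \<open>Vectors in $\mathbb R^d$ are extensional functions on \<open>{1..d}\<close>; the product topology on
  \<open>nat \<Rightarrow> real\<close> induces the Euclidean topology on them.\<close>

definition pos_sphere :: "nat \<Rightarrow> (nat \<Rightarrow> real) set" where
  "pos_sphere d = {\<theta> \<in> {1..d} \<rightarrow>\<^sub>E {0..}. L2_set \<theta> {1..d} = 1}"

definition radial_part :: "nat \<Rightarrow> (nat \<Rightarrow> 'a \<Rightarrow> real) \<Rightarrow> 'a \<Rightarrow> real" where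
  "radial_part d Y w = L2_set (\<lambda>i. Y i w) {1..d}"

definition angular_part :: "nat \<Rightarrow> (nat \<Rightarrow> 'a \<Rightarrow> real) \<Rightarrow> 'a \<Rightarrow> nat \<Rightarrow> real" where
  "angular_part d Y w = (\<lambda>i\<in>{1..d}. Y i w / radial_part d Y w)"

text \<open>The measure $\nu_2$ on $(0,\infty]$ with density $2x^{-3}$ and no mass at $\infty$.\<close>

definition nu2 :: "ereal measure" where
  "nu2 = distr (density lborel (\<lambda>x. ennreal (2 / x ^ 3) * indicator {0<..} x)) borel ereal"

text \<open>The spectral measure \<open>H\<close> is a finite measure on the ambient space \<open>nat \<Rightarrow> real\<close> that is
  concentrated on the positive sphere.\<close>

definition RV2 :: "'a measure \<Rightarrow> nat \<Rightarrow> (nat \<Rightarrow> 'a \<Rightarrow> real) \<Rightarrow> bool" where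
  "RV2 M d Y \<longleftrightarrow>
     (\<forall>i\<in>{1..d}. Y i \<in> borel_measurable M \<and> (AE w in M. 0 \<le> Y i w)) \<and>
     (\<exists>H :: (nat \<Rightarrow> real) measure.
        finite_measure H \<and> sets H = sets borel \<and> emeasure H (- pos_sphere d) = 0 \<and>
        vaguely_converges_on ({0<..} \<times> pos_sphere d)
          (\<lambda>n. scale_measure (of_nat n)
             (distr M borel (\<lambda>w. (ereal (radial_part d Y w / sqrt n), angular_part d Y w))))
          (nu2 \<Otimes>\<^sub>M H))"

definition standardized_innovations :: "'a measure \<Rightarrow> nat \<Rightarrow> (nat \<Rightarrow> 'a \<Rightarrow> real) \<Rightarrow> bool" where
  "standardized_innovations M d Z \<longleftrightarrow>
     RV2 M d Z \<and>
     prob_space.indep_vars M (\<lambda>_. borel) Z {1..d} \<and>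
     (\<forall>i\<in>{1..d}. \<forall>x>0.
        (\<lambda>n. real n * measure M {w \<in> space M. Z i w / sqrt n > x}) \<longlonglongrightarrow> 1 / x\<^sup>2)"

definition sq_scaling :: "'a measure \<Rightarrow> ('a \<Rightarrow> real) \<Rightarrow> real" where
  "sq_scaling M Y = lim (\<lambda>n. real n * measure M {w \<in> space M. Y w > sqrt n})"

definition partial_max :: "(nat \<Rightarrow> 'a \<Rightarrow> real) \<Rightarrow> nat set \<Rightarrow> 'a \<Rightarrow> real" where
  "partial_max X h w = Max ((\<lambda>i. X i w) ` h)"


section \<open>The linear system\<close>

text \<open>Block \<open>i\<close> of \<open>S_M\<close> runs through $\{i,i+1,\dots,d\}, \{i,i+2,\dots,d\}, \dots, \{i,d\}, \{i\}$,
  that is, through $\{i\} \cup \{j+1,\dots,d\}$ for $j = i,\dots,d$. The last one gives $\sigma_i^2$.\<close>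

definition S_M_vec :: "'a measure \<Rightarrow> nat \<Rightarrow> (nat \<Rightarrow> 'a \<Rightarrow> real) \<Rightarrow> real Matrix.vec" where
  "S_M_vec M d X =
     vec_of_list (concat (map (\<lambda>i. map (\<lambda>j. sq_scaling M (partial_max X ({i} \<union> {j<..d})))
       [i..<Suc d]) [1..<Suc d]))"

definition A_sq_vec :: "nat \<Rightarrow> (nat \<Rightarrow> nat \<Rightarrow> real) \<Rightarrow> real Matrix.vec" where
  "A_sq_vec d A =
     vec_of_list (concat (map (\<lambda>i. map (\<lambda>j. (A i j)\<^sup>2) [i..<Suc d]) [1..<Suc d]))"

text \<open>The formula $(j-d)+\sum_{k=0}^{i-1}(d-k)$, reordered so that the subtraction on natural
  numbers does not truncate for $1 \le i \le j \le d$. Positions are counted from 1.\<close>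

definition pos_index :: "nat \<Rightarrow> nat \<Rightarrow> nat \<Rightarrow> nat" where
  "pos_index d i j = (\<Sum>k=0..<i. d - k) + j - d"

definition T_plus :: "nat \<Rightarrow> (nat \<times> nat) set" where
  "T_plus d = (let l = pos_index d in
       {(l i i, l i i) | i. 1 \<le> i \<and> i < d}
     \<union> {(l d d, l d d)}
     \<union> {(l i j, l i j) | i j. 1 \<le> i \<and> i < j \<and> j < d}
     \<union> {(l i j, l j j) | i j. 1 \<le> i \<and> i < j \<and> j < d}
     \<union> {(l i d, l i d) | i. 1 \<le> i \<and> i < d}
     \<union> {(l i d, l d d) | i. 1 \<le> i \<and> i < d})"

definition T_minus :: "nat \<Rightarrow> (nat \<times> nat) set" where
  "T_minus d = (let l = pos_index d in
       {(l i i, l (i + 1) (i + 1)) | i. 1 \<le> i \<and> i < d}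
     \<union> {(l i j, l (j + 1) (j + 1)) | i j. 1 \<le> i \<and> i < j \<and> j < d}
     \<union> {(l i j, l i (j - 1)) | i j. 1 \<le> i \<and> i < j \<and> j < d}
     \<union> {(l i d, l i (d - 1)) | i. 1 \<le> i \<and> i < d})"

text \<open>Matrix indices start at 0, positions at 1.\<close>

definition T_mat :: "nat \<Rightarrow> real Matrix.mat" where
  "T_mat d = Matrix.mat (d * (d + 1) div 2) (d * (d + 1) div 2) (\<lambda>(u, v).
     if (Suc u, Suc v) \<in> T_plus d then 1
     else if (Suc u, Suc v) \<in> T_minus d then - 1
     else 0)"


section \<open>Upper triangularity, standardization and max-linear representation\<close>

lemma well_ordered_trancl:
  assumes "well_ordered_dag d E" "(u, v) \<in> E\<^sup>+"
  shows "v < u"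
  using assms(2)
proof (induction rule: trancl_induct)
  case (base y)
  then show ?case
    using assms(1) by (fastforce simp: well_ordered_dag_def dag_on_def parents_def)
next
  case (step y z)
  then have "z < y"
    using assms(1) by (fastforce simp: well_ordered_dag_def dag_on_def parents_def)
  with step.IH show ?case by simp
qed

lemma ml_coeff_upper_triangular:
  assumes "well_ordered_dag d E" "j < i"
  shows "ml_coeff E c i j = 0"
  using assms(2) well_ordered_trancl[OF assms(1), of j i]
  by (auto simp: ml_coeff_def ancestors_def)

lemma ml_coeff_diag:
  assumes "well_ordered_dag d E"
  shows "ml_coeff E c i i = c i i"
  using well_ordered_trancl[OF assms, of i i] by (auto simp: ml_coeff_def ancestors_def)

lemma path_nodes:
  assumes "E \<subseteq> V \<times> V" "2 \<le> length p" "successively (\<lambda>u v. (u, v) \<in> E) p"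
  shows "set p \<subseteq> V"
  using assms(2,3)
proof (induction p)
  case (Cons a p)
  show ?case
  proof (cases "2 \<le> length p")
    case True
    with Cons assms(1) show ?thesis by (cases p) auto
  next
    case False
    with Cons.prems obtain b where "p = [b]" by (cases p; cases "tl p") auto
    with Cons.prems assms(1) show ?thesis by auto
  qed
qed auto

lemma finite_paths:
  assumes "well_ordered_dag d E"
  shows "finite (paths E j i)"
proof (rule finite_subset)
  show "finite {p. set p \<subseteq> {1..d} \<and> distinct p}"
    by (rule finite_subset_distinct) simp
  show "paths E j i \<subseteq> {p. set p \<subseteq> {1..d} \<and> distinct p}"
  proof
    fix p assume p: "p \<in> paths E j i"
    have E: "E \<subseteq> {1..d} \<times> {1..d}"
      using assms by (simp add: well_ordered_dag_def dag_on_def)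
    have "successively (>) p"
      using p well_ordered_trancl[OF assms]
      by (auto simp: paths_def intro: successively_mono)
    then have "sorted_wrt (>) p"
      by (subst (asm) successively_conv_sorted_wrt) (auto intro: transpI)
    then have "distinct p"
      by (induction p) auto
    with p path_nodes[OF E] show "p \<in> {p. set p \<subseteq> {1..d} \<and> distinct p}"
      by (auto simp: paths_def)
  qed
qed

lemma paths_nonempty:
  assumes "(j, i) \<in> E\<^sup>+"
  shows "paths E j i \<noteq> {}"
  using assms
proof (induction rule: trancl_induct)
  case (base y)
  then have "[j, y] \<in> paths E j y" by (simp add: paths_def)
  then show ?case by blast
next
  case (step y z)
  then obtain p where "p \<in> paths E j y" by blast
  with step have "p @ [z] \<in> paths E j z"
    by (auto simp: paths_def successively_append_iff hd_append)
  then show ?case by blast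
qed

lemma Max_mult_image:
  fixes S :: "real set"
  assumes "finite S" "S \<noteq> {}" "0 \<le> r"
  shows "Max ((\<lambda>x. x * r) ` S) = Max S * r"
  using mono_Max_commute[of "\<lambda>x. x * r" S] assms
  by (simp add: mono_def mult_right_mono)

text \<open>Dividing the components of a recursive max-linear vector by the row norms of its
  coefficient matrix gives a recursive max-linear vector on the same graph, whose coefficient
  matrix is the row-normalized one. So a standardized vector is one whose own coefficient matrix
  satisfies \<open>standardized\<close>.\<close>

lemma standardize_recursive_ML:
  fixes M :: "'a measure" and d :: nat and E :: "(nat \<times> nat) set"
    and c :: "nat \<Rightarrow> nat \<Rightarrow> real"
  defines "s \<equiv> \<lambda>i. sqrt (\<Sum>k\<in>{1..d}. (ml_coeff E c i k)\<^sup>2)"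
  defines "c' \<equiv> \<lambda>i k. if k = i then c i i / s i else c i k * s k / s i"
  assumes wo: "well_ordered_dag d E" and pos: "positive_weights d E c"
    and ml: "recursive_ML_vector M d E c Z X"
  shows "positive_weights d E c'"
    and "recursive_ML_vector M d E c' Z (\<lambda>i w. X i w / s i)"
    and "\<forall>i\<in>{1..d}. \<forall>j\<in>{1..d}. ml_coeff E c' i j = ml_coeff E c i j / s i"
    and "standardized d (ml_coeff E c')"
proof -
  have E: "E \<subseteq> {1..d} \<times> {1..d}"
    using wo by (simp add: well_ordered_dag_def dag_on_def)
  have edge: "v < u" "u \<in> {1..d}" "v \<in> {1..d}" if "(u, v) \<in> E" for u v
    using that E well_ordered_trancl[OF wo, of u v] by auto
  have s_pos: "0 < s i" if i: "i \<in> {1..d}" for i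
  proof -
    have "0 < c i i" using pos i by (simp add: positive_weights_def)
    moreover have "(c i i)\<^sup>2 \<le> (\<Sum>k\<in>{1..d}. (ml_coeff E c i k)\<^sup>2)"
      using member_le_sum[of i "{1..d}" "\<lambda>k. (ml_coeff E c i k)\<^sup>2"] i
      by (simp add: ml_coeff_diag[OF wo])
    ultimately show ?thesis
      unfolding s_def by (smt (verit) real_sqrt_gt_zero zero_less_power2)
  qed
  have c'_edge: "c' v u = c v u * s u / s v" if "(u, v) \<in> E" for u v
    using edge(1)[OF that] by (simp add: c'_def)
  show "positive_weights d E c'"
    using pos s_pos edge(2) by (auto simp: positive_weights_def c'_def parents_def)
  show "recursive_ML_vector M d E c' Z (\<lambda>i w. X i w / s i)"
    unfolding recursive_ML_vector_def
  proof (intro ballI)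
    fix i w assume i: "i \<in> {1..d}" and w: "w \<in> space M"
    let ?S = "insert (c i i * Z i w) ((\<lambda>k. c i k * X k w) ` parents E i)"
    have fin: "finite (parents E i)"
      by (rule finite_subset[of _ "{1..d}"]) (auto simp: parents_def dest: edge(2))
    have "(\<lambda>k. c' i k * (X k w / s k)) ` parents E i
          = (\<lambda>k. c i k * X k w * (1 / s i)) ` parents E i"
    proof (rule image_cong[OF refl])
      fix k assume "k \<in> parents E i"
      then have "(k, i) \<in> E" by (simp add: parents_def)
      with s_pos[OF edge(2)] show "c' i k * (X k w / s k) = c i k * X k w * (1 / s i)"
        by (fastforce simp: c'_edge)
    qed
    then have "insert (c' i i * Z i w) ((\<lambda>k. c' i k * (X k w / s k)) ` parents E i)
               = (\<lambda>x. x * (1 / s i)) ` ?S"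
      by (simp add: image_image c'_def)
    moreover have "Max ((\<lambda>x. x * (1 / s i)) ` ?S) = Max ?S * (1 / s i)"
      using fin s_pos[OF i] by (intro Max_mult_image) auto
    moreover have "X i w = Max ?S"
      using ml i w by (simp add: recursive_ML_vector_def)
    ultimately show "X i w / s i
        = Max (insert (c' i i * Z i w) ((\<lambda>k. c' i k * (X k w / s k)) ` parents E i))"
      by simp
  qed
  have pw: "path_weight c' p = path_weight c p * (1 / s i)" if p: "p \<in> paths E j i" for p j i
  proof -
    from p have len: "2 \<le> length p" and ends: "hd p = j" "last p = i"
      and succ: "successively (\<lambda>u v. (u, v) \<in> E) p"
      by (auto simp: paths_def)
    have "p \<noteq> []" using len by auto
    have e: "(p ! r, p ! Suc r) \<in> E" if "r < length p - 1" for r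
      using succ that by (simp add: successively_conv_nth)
    have nz: "s (p ! r) \<noteq> 0" if "r < length p" for r
      using s_pos path_nodes[OF E len succ] that by (metis less_irrefl nth_mem subsetD)
    have tel: "(\<Prod>r<n. s (p ! r) / s (p ! Suc r)) = s (p ! 0) / s (p ! n)"
      if "n < length p" for n
      using that
    proof (induction n)
      case 0
      with nz show ?case by auto
    next
      case (Suc n)
      with nz[of n] show ?case by simp
    qed
    have "(\<Prod>r<length p - 1. c' (p ! Suc r) (p ! r))
          = (\<Prod>r<length p - 1. c (p ! Suc r) (p ! r) * (s (p ! r) / s (p ! Suc r)))"
      by (rule prod.cong) (simp_all add: c'_edge[OF e])
    also have "\<dots> = (\<Prod>r<length p - 1. c (p ! Suc r) (p ! r)) * (s j / s i)"
      unfolding prod.distrib using tel[of "length p - 1"] \<open>p \<noteq> []\<close> ends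
      by (simp add: hd_conv_nth last_conv_nth)
    finally show ?thesis
      using nz[of 0] \<open>p \<noteq> []\<close> ends by (simp add: path_weight_def c'_def hd_conv_nth)
  qed
  show coeff: "\<forall>i\<in>{1..d}. \<forall>j\<in>{1..d}. ml_coeff E c' i j = ml_coeff E c i j / s i"
  proof (intro ballI)
    fix i j assume i: "i \<in> {1..d}"
    have "Max (path_weight c' ` paths E j i) = Max (path_weight c ` paths E j i) / s i"
      if "(j, i) \<in> E\<^sup>+"
    proof -
      have "path_weight c' ` paths E j i = (\<lambda>x. x * (1 / s i)) ` path_weight c ` paths E j i"
        unfolding image_image by (rule image_cong) (auto simp: pw)
      then show ?thesis
        using Max_mult_image[of "path_weight c ` paths E j i" "1 / s i"]
          finite_paths[OF wo] paths_nonempty[OF that] s_pos[OF i] by simp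
    qed
    then show "ml_coeff E c' i j = ml_coeff E c i j / s i"
      by (auto simp: ml_coeff_def ancestors_def c'_def)
  qed
  show "standardized d (ml_coeff E c')"
    unfolding standardized_def
  proof
    fix i assume i: "i \<in> {1..d}"
    have "(\<Sum>k\<in>{1..d}. (ml_coeff E c' i k)\<^sup>2) = (\<Sum>k\<in>{1..d}. (ml_coeff E c i k)\<^sup>2 / (s i)\<^sup>2)"
      by (rule sum.cong) (use coeff i in \<open>auto simp: power_divide\<close>)
    also have "\<dots> = (\<Sum>k\<in>{1..d}. (ml_coeff E c i k)\<^sup>2) / (s i)\<^sup>2"
      by (simp add: sum_divide_distrib)
    also have "(s i)\<^sup>2 = (\<Sum>k\<in>{1..d}. (ml_coeff E c i k)\<^sup>2)"
      by (simp add: s_def sum_nonneg)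
    finally show "(\<Sum>k\<in>{1..d}. (ml_coeff E c' i k)\<^sup>2) = 1"
      using s_pos[OF i] by (auto simp: s_def)
  qed
qed

text \<open>The max-linear representation $X = A \times_{\max} Z$. It holds almost surely, namely
  wherever the innovations are nonnegative.\<close>

lemma path_weight_snoc:
  assumes "p \<noteq> []"
  shows "path_weight c (p @ [i]) = c i (last p) * path_weight c p"
proof -
  from assms obtain n where n: "length p = Suc n" by (cases p) auto
  with assms have "last p = p ! n" by (simp add: last_conv_nth)
  moreover have "(\<Prod>r<n. c ((p @ [i]) ! Suc r) ((p @ [i]) ! r)) = (\<Prod>r<n. c (p ! Suc r) (p ! r))"
    using n by (intro prod.cong) (auto simp: nth_append)
  ultimately show ?thesis
    using assms n by (simp add: path_weight_def nth_append)
qed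

lemma recursive_ML_vector_representation:
  assumes wo: "well_ordered_dag d E" and pos: "positive_weights d E c"
    and ml: "recursive_ML_vector M d E c Z X"
    and i: "i \<in> {1..d}" and w: "w \<in> space M" and Z: "\<forall>j\<in>{1..d}. 0 \<le> Z j w"
  shows "X i w = Max ((\<lambda>j. ml_coeff E c i j * Z j w) ` {1..d})"
proof -
  have E: "E \<subseteq> {1..d} \<times> {1..d}"
    using wo by (simp add: well_ordered_dag_def dag_on_def)
  have fin: "finite (parents E i)" for i
    by (rule finite_subset[of _ "{1..d}"]) (use E in \<open>auto simp: parents_def\<close>)
  have X: "X i w = Max (insert (c i i * Z i w) ((\<lambda>k. c i k * X k w) ` parents E i))"
    if "i \<in> {1..d}" for i
    using ml w that by (simp add: recursive_ML_vector_def)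
  have X_self: "c i i * Z i w \<le> X i w" if "i \<in> {1..d}" for i
    unfolding X[OF that] using fin by (intro Max_ge) auto
  have X_edge: "c i k * X k w \<le> X i w" if "(k, i) \<in> E" for i k
  proof -
    have "i \<in> {1..d}" using that E by auto
    from X[OF this] show ?thesis
      using fin that by (auto simp: parents_def intro!: Max_ge)
  qed
  have c_self: "0 < c i i" if "i \<in> {1..d}" for i
    using pos that by (simp add: positive_weights_def)
  have c_edge: "0 < c i k" if "(k, i) \<in> E" for i k
    using pos that E by (auto simp: positive_weights_def parents_def)
  have lower_path: "path_weight c p * Z (hd p) w \<le> X (last p) w"
    if "p \<noteq> []" "set p \<subseteq> {1..d}" "successively (\<lambda>u v. (u, v) \<in> E) p" for p
    using that
  proof (induction p rule: rev_nonempty_induct)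
    case (single x)
    then show ?case using X_self by (simp add: path_weight_def)
  next
    case (snoc x p)
    then have e: "(last p, x) \<in> E" and IH: "path_weight c p * Z (hd p) w \<le> X (last p) w"
      by (auto simp: successively_append_iff)
    have "path_weight c (p @ [x]) * Z (hd (p @ [x])) w
        = c x (last p) * (path_weight c p * Z (hd p) w)"
      using snoc.hyps by (simp add: path_weight_snoc)
    also have "\<dots> \<le> c x (last p) * X (last p) w"
      using IH c_edge[OF e] by (simp add: mult_left_mono)
    also have "\<dots> \<le> X x w" by (rule X_edge[OF e])
    finally show ?case by simp
  qed
  have Max_path: "\<exists>p\<in>paths E j i. ml_coeff E c i j = path_weight c p"
    if "(j, i) \<in> E\<^sup>+" for i j
  proof -
    have "Max (path_weight c ` paths E j i) \<in> path_weight c ` paths E j i"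
      using finite_paths[OF wo] paths_nonempty[OF that] by (intro Max_in) auto
    with that show ?thesis by (auto simp: ml_coeff_def ancestors_def)
  qed
  have path_le: "path_weight c p \<le> ml_coeff E c i j" if "p \<in> paths E j i" for p i j
  proof -
    from that have "2 \<le> length p" "hd p = j" "last p = i"
      and "successively (\<lambda>u v. (u, v) \<in> E) p" by (auto simp: paths_def)
    then have "(j, i) \<in> E\<^sup>+"
    proof (induction p arbitrary: j)
      case (Cons a p)
      show ?case
      proof (cases "2 \<le> length p")
        case True
        then have "p \<noteq> []" by auto
        with Cons.prems have "(j, hd p) \<in> E" "successively (\<lambda>u v. (u, v) \<in> E) p" "last p = i"
          by (auto simp: successively_Cons)
        with Cons.IH[OF True] show ?thesis by (meson trancl_into_trancl2)
      next
        case False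
        with Cons.prems obtain b where "p = [b]" by (cases p; cases "tl p") auto
        with Cons.prems show ?thesis by auto
      qed
    qed simp
    with that finite_paths[OF wo] show ?thesis
      by (auto simp: ml_coeff_def ancestors_def intro!: Max_ge)
  qed
  have lower: "ml_coeff E c i j * Z j w \<le> X i w" if ij: "i \<in> {1..d}" "j \<in> {1..d}" for i j
  proof (cases "(j, i) \<in> E\<^sup>+")
    case True
    then obtain p where p: "p \<in> paths E j i" "ml_coeff E c i j = path_weight c p"
      using Max_path by blast
    moreover have "set p \<subseteq> {1..d}" using p path_nodes[OF E] by (simp add: paths_def)
    ultimately show ?thesis using lower_path[of p] by (force simp: paths_def)
  next
    case False
    have "0 \<le> X i w"
      using X_self[of i] c_self[of i] Z ij by (smt (verit) mult_nonneg_nonneg)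
    with False X_self ij show ?thesis by (auto simp: ml_coeff_def ancestors_def)
  qed
  have upper: "\<exists>j\<in>{1..d}. X i w \<le> ml_coeff E c i j * Z j w" if "i \<in> {1..d}" for i
    using that
  proof (induction "d - i" arbitrary: i rule: less_induct)
    case less
    have "X i w \<in> insert (c i i * Z i w) ((\<lambda>k. c i k * X k w) ` parents E i)"
      unfolding X[OF less.prems] using fin by (intro Max_in) auto
    then consider "X i w = c i i * Z i w" | k where "(k, i) \<in> E" "X i w = c i k * X k w"
      by (auto simp: parents_def)
    then show ?case
    proof cases
      case 1
      with less.prems show ?thesis by (force simp: ml_coeff_diag[OF wo])
    next
      case (2 k)
      have k: "k \<in> {1..d}" "i < k" using 2 E well_ordered_trancl[OF wo, of k i] by auto
      with less obtain j where j: "j \<in> {1..d}" "X k w \<le> ml_coeff E c k j * Z j w"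
        by (metis atLeastAtMost_iff diff_less_mono2 less_le_trans)
      have "c i k * ml_coeff E c k j \<le> ml_coeff E c i j \<or> ml_coeff E c k j = 0"
      proof -
        consider "(j, k) \<in> E\<^sup>+" | "j = k" | "(j, k) \<notin> E\<^sup>+" "j \<noteq> k" by blast
        then show ?thesis
        proof cases
          case 1
          then obtain p where p: "p \<in> paths E j k" "ml_coeff E c k j = path_weight c p"
            using Max_path by blast
          then have "p @ [i] \<in> paths E j i" "p \<noteq> []" "last p = k"
            using \<open>(k, i) \<in> E\<close> by (auto simp: paths_def successively_append_iff hd_append)
          with path_le[of "p @ [i]" j i] p show ?thesis by (simp add: path_weight_snoc)
        next
          case eq: 2
          have "[k, i] \<in> paths E k i" using \<open>(k, i) \<in> E\<close> by (simp add: paths_def)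
          from path_le[OF this] eq show ?thesis
            by (simp add: path_weight_def ml_coeff_diag[OF wo] mult.commute)
        next
          case 3
          then show ?thesis by (simp add: ml_coeff_def ancestors_def)
        qed
      qed
      then show ?thesis
      proof
        assume le: "c i k * ml_coeff E c k j \<le> ml_coeff E c i j"
        have "X i w \<le> c i k * (ml_coeff E c k j * Z j w)"
          using 2 j c_edge[OF \<open>(k, i) \<in> E\<close>] by (simp add: mult_left_mono)
        also have "\<dots> \<le> ml_coeff E c i j * Z j w"
          using le Z j by (simp add: mult_right_mono flip: mult.assoc)
        finally show ?thesis using j by blast
      next
        assume "ml_coeff E c k j = 0"
        then have "X i w \<le> 0"
          using 2 j c_edge[OF \<open>(k, i) \<in> E\<close>] by (simp add: mult_nonneg_nonpos)
        also have "0 \<le> ml_coeff E c i i * Z i w"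
          using c_self[OF less.prems] Z less.prems by (simp add: ml_coeff_diag[OF wo])
        finally show ?thesis using less.prems by blast
      qed
    qed
  qed
  from upper[OF i] obtain j where "j \<in> {1..d}" "X i w \<le> ml_coeff E c i j * Z j w" by blast
  with lower[OF i] have "X i w = ml_coeff E c i j * Z j w" by (meson order_antisym)
  with lower[OF i] \<open>j \<in> {1..d}\<close> show ?thesis
    by (intro Max_eqI[symmetric]) auto
qed

end

theory Submission
  imports Defs
begin

text \<open>The tails of independent innovations add up, so the squared scaling of \<open>M\<^sub>h\<close> is the sum over
  \<open>k\<close> of the squares of \<open>max {a\<^sub>i\<^sub>k | i \<in> h}\<close>. In a standardized matrix the diagonal entry dominates
  its column, because \<open>a\<^sub>i\<^sub>k a\<^sub>k\<^sub>j \<le> a\<^sub>k\<^sub>k a\<^sub>i\<^sub>j\<close> and the rows have norm 1. Hence for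
  \<open>h = {i} \<union> {j+1,\<dots>,d}\<close> with \<open>i \<le> j\<close> the squared scaling is the sum of \<open>a\<^sub>i\<^sub>k\<^sup>2\<close> over \<open>k \<le> j\<close> plus
  the sum of \<open>a\<^sub>k\<^sub>k\<^sup>2\<close> over \<open>k > j\<close>, and the rows of \<open>T\<close> are the differences that isolate
  \<open>a\<^sub>i\<^sub>j\<^sup>2\<close>.\<close>

section \<open>Column domination in a standardized coefficient matrix\<close>

lemma path_weight_nonneg:
  assumes wo: "well_ordered_dag d E" and pos: "positive_weights d E c"
    and p: "p \<noteq> []" "hd p \<in> {1..d}" "successively (\<lambda>u v. (u, v) \<in> E) p"
  shows "0 \<le> path_weight c p"
  using p
proof (induction p rule: rev_nonempty_induct)
  case (single x)
  then show ?case
    using pos by (auto simp: path_weight_def positive_weights_def intro: less_imp_le)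
next
  case (snoc x p)
  then have "(last p, x) \<in> E" and "0 \<le> path_weight c p"
    by (auto simp: successively_append_iff)
  moreover from this have "0 < c x (last p)"
    using wo pos by (auto simp: well_ordered_dag_def dag_on_def positive_weights_def parents_def)
  ultimately show ?case
    using snoc.hyps by (simp add: path_weight_snoc)
qed

lemma ml_coeff_attained:
  assumes "well_ordered_dag d E" "(j, i) \<in> E\<^sup>+"
  obtains p where "p \<in> paths E j i" "ml_coeff E c i j = path_weight c p"
proof -
  have "Max (path_weight c ` paths E j i) \<in> path_weight c ` paths E j i"
    using finite_paths[OF assms(1)] paths_nonempty[OF assms(2)] by (intro Max_in) auto
  with assms(2) that show ?thesis by (auto simp: ml_coeff_def ancestors_def)
qed

lemma ml_coeff_nonneg:
  assumes wo: "well_ordered_dag d E" and pos: "positive_weights d E c" and i: "i \<in> {1..d}"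
  shows "0 \<le> ml_coeff E c i j"
proof (cases "(j, i) \<in> E\<^sup>+")
  case True
  then obtain p where p: "p \<in> paths E j i" "ml_coeff E c i j = path_weight c p"
    using ml_coeff_attained[OF wo] by blast
  have "E \<subseteq> {1..d} \<times> {1..d}"
    using wo by (simp add: well_ordered_dag_def dag_on_def)
  moreover obtain z where "(j, z) \<in> E" using True by (meson tranclD)
  ultimately have "j \<in> {1..d}" by blast
  with p have "p \<noteq> []" "hd p \<in> {1..d}" "successively (\<lambda>u v. (u, v) \<in> E) p"
    by (auto simp: paths_def)
  with path_weight_nonneg[OF wo pos] p(2) show ?thesis by simp
next
  case False
  with pos i show ?thesis
    by (auto simp: ml_coeff_def ancestors_def positive_weights_def intro: less_imp_le)
qed

lemma path_weight_le_ml_coeff: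
  assumes "well_ordered_dag d E" "(j, i) \<in> E\<^sup>+" "p \<in> paths E j i"
  shows "path_weight c p \<le> ml_coeff E c i j"
  using assms finite_paths[OF assms(1)] by (auto simp: ml_coeff_def ancestors_def intro!: Max_ge)

text \<open>Appending the edge \<open>m \<rightarrow> i\<close> to a heaviest path from
  \<open>j\<close> to \<open>m\<close> gives a path from \<open>j\<close> to \<open>i\<close>. The
  case \<open>j = m\<close> is separate because lists in \<open>paths\<close> have at least one
  edge.\<close>

lemma ml_coeff_edge:
  assumes wo: "well_ordered_dag d E" and pos: "positive_weights d E c" and e: "(m, i) \<in> E"
  shows "c i m * ml_coeff E c m j \<le> ml_coeff E c i j"
proof -
  consider "(j, m) \<in> E\<^sup>+" | "j = m" | "(j, m) \<notin> E\<^sup>+" "j \<noteq> m" by blast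
  then show ?thesis
  proof cases
    case 1
    then obtain p where p: "p \<in> paths E j m" "ml_coeff E c m j = path_weight c p"
      using ml_coeff_attained[OF wo] by blast
    then have "p @ [i] \<in> paths E j i" "p \<noteq> []" "last p = m"
      using e by (auto simp: paths_def successively_append_iff hd_append)
    with path_weight_le_ml_coeff[OF wo, of j i "p @ [i]" c] 1 e p show ?thesis
      by (simp add: path_weight_snoc trancl_into_trancl)
  next
    case 2
    have "[m, i] \<in> paths E m i" using e by (simp add: paths_def)
    with path_weight_le_ml_coeff[OF wo, of m i "[m, i]" c] 2 e show ?thesis
      by (simp add: path_weight_def ml_coeff_diag[OF wo] mult.commute r_into_trancl)
  next
    case 3
    have "i \<in> {1..d}" using wo e by (auto simp: well_ordered_dag_def dag_on_def)
    with 3 show ?thesis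
      using ml_coeff_nonneg[OF wo pos, of i j] by (simp add: ml_coeff_def ancestors_def)
  qed
qed

text \<open>A path from \<open>j\<close> to \<open>k\<close> followed by one from \<open>k\<close>
  to \<open>i\<close> is a path from \<open>j\<close> to \<open>i\<close>. The weight of the second
  piece carries the additional innovation factor \<open>c k k\<close>, which is the diagonal
  coefficient on the right.\<close>

lemma ml_coeff_supermult:
  assumes wo: "well_ordered_dag d E" and pos: "positive_weights d E c"
    and i: "i \<in> {1..d}" and k: "k \<in> {1..d}"
  shows "ml_coeff E c i k * ml_coeff E c k j \<le> ml_coeff E c k k * ml_coeff E c i j"
proof -
  have ckk: "0 < c k k" using pos k by (simp add: positive_weights_def)
  \<comment> \<open>Instead of concatenating two paths, the path that leaves \<open>k\<close> grows
    by one edge at a time. The one-node list starts the induction with equality.\<close>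
  have path: "path_weight c p * ml_coeff E c k j \<le> c k k * ml_coeff E c (last p) j"
    if "p \<noteq> []" "hd p = k" "successively (\<lambda>u v. (u, v) \<in> E) p" for p
    using that
  proof (induction p rule: rev_nonempty_induct)
    case (single x)
    then show ?case by (simp add: path_weight_def)
  next
    case (snoc x p)
    then have e: "(last p, x) \<in> E"
      and IH: "path_weight c p * ml_coeff E c k j \<le> c k k * ml_coeff E c (last p) j"
      by (auto simp: successively_append_iff)
    have "0 < c x (last p)"
      using wo pos e
      by (auto simp: well_ordered_dag_def dag_on_def positive_weights_def parents_def)
    then have "path_weight c (p @ [x]) * ml_coeff E c k j
        \<le> c x (last p) * (c k k * ml_coeff E c (last p) j)"
      using IH snoc.hyps by (simp add: path_weight_snoc mult.assoc mult_left_mono)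
    also have "\<dots> = c k k * (c x (last p) * ml_coeff E c (last p) j)" by simp
    also have "\<dots> \<le> c k k * ml_coeff E c x j"
      using ml_coeff_edge[OF wo pos e] ckk by (intro mult_left_mono) auto
    finally show ?case by simp
  qed
  show ?thesis
  proof (cases "(k, i) \<in> E\<^sup>+")
    case True
    then obtain p where "p \<in> paths E k i" "ml_coeff E c i k = path_weight c p"
      using ml_coeff_attained[OF wo] by blast
    moreover from this have "p \<noteq> []" by (auto simp: paths_def)
    ultimately show ?thesis using path[of p] by (auto simp: paths_def ml_coeff_diag[OF wo])
  next
    case False
    show ?thesis
    proof (cases "k = i")
      case k_ne: False
      with False have "ml_coeff E c i k = 0" by (simp add: ml_coeff_def ancestors_def)
      then show ?thesis
        using ml_coeff_nonneg[OF wo pos i, of j] ckk by (simp add: ml_coeff_diag[OF wo])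
    qed simp
  qed
qed

text \<open>Squaring \<open>a\<^sub>i\<^sub>k a\<^sub>k\<^sub>j \<le> a\<^sub>k\<^sub>k a\<^sub>i\<^sub>j\<close> and summing over \<open>j\<close>, both row norms being 1.\<close>

lemma ml_coeff_le_diag:
  assumes wo: "well_ordered_dag d E" and pos: "positive_weights d E c"
    and std: "standardized d (ml_coeff E c)" and i: "i \<in> {1..d}" and k: "k \<in> {1..d}"
  shows "ml_coeff E c i k \<le> ml_coeff E c k k"
proof -
  let ?a = "ml_coeff E c"
  have "(?a i k)\<^sup>2 = (\<Sum>j\<in>{1..d}. (?a i k * ?a k j)\<^sup>2)"
    using std k by (simp add: power_mult_distrib standardized_def flip: sum_distrib_left)
  also have "\<dots> \<le> (\<Sum>j\<in>{1..d}. (?a k k * ?a i j)\<^sup>2)"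
    using ml_coeff_supermult[OF wo pos i k] ml_coeff_nonneg[OF wo pos] i k
    by (intro sum_mono power_mono mult_nonneg_nonneg) auto
  also have "\<dots> = (?a k k)\<^sup>2"
    using std i by (simp add: power_mult_distrib standardized_def flip: sum_distrib_left)
  finally show ?thesis
    using ml_coeff_nonneg[OF wo pos k] power2_le_imp_le by blast
qed


section \<open>Scalings of max-linear combinations\<close>

text \<open>Each \<open>p j n\<close> is of order \<open>1 / n\<close>, so the mixed products in the
  expansion vanish in the limit even after multiplication by \<open>n\<close>.\<close>

lemma one_minus_prod_limit:
  fixes p :: "'b \<Rightarrow> nat \<Rightarrow> real"
  assumes "finite J" "\<And>j. j \<in> J \<Longrightarrow> (\<lambda>n. real n * p j n) \<longlonglongrightarrow> l j"
  shows "(\<lambda>n. real n * (1 - (\<Prod>j\<in>J. 1 - p j n))) \<longlonglongrightarrow> (\<Sum>j\<in>J. l j)"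
  using assms
proof (induction J rule: finite_induct)
  case (insert x J)
  define Q where "Q n = (\<Prod>j\<in>J. 1 - p j n)" for n
  have Q: "(\<lambda>n. real n * (1 - Q n)) \<longlonglongrightarrow> (\<Sum>j\<in>J. l j)"
    using insert by (simp add: Q_def)
  have px: "(\<lambda>n. real n * p x n) \<longlonglongrightarrow> l x" using insert by simp
  \<comment> \<open>This is \<open>1 - (1 - p) * Q = p + (1 - Q) - p * (1 - Q)\<close> times
    \<open>n\<close>. The last term is split into two convergent factors and
    \<open>1 / n\<close>.\<close>
  have "(\<lambda>n. real n * p x n + real n * (1 - Q n)
          - (real n * p x n) * (real n * (1 - Q n)) * (1 / real n))
        \<longlonglongrightarrow> l x + (\<Sum>j\<in>J. l j) - l x * (\<Sum>j\<in>J. l j) * 0"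
    by (intro tendsto_intros px Q lim_1_over_n)
  moreover have "real n * p x n + real n * (1 - Q n)
          - (real n * p x n) * (real n * (1 - Q n)) * (1 / real n)
        = real n * (1 - (\<Prod>j\<in>insert x J. 1 - p j n))" for n
    using insert.hyps by (cases "n = 0") (simp_all add: Q_def field_simps)
  ultimately show ?case using insert.hyps by simp
qed simp

text \<open>Independence turns the probability that no term exceeds \<open>sqrt n\<close> into a
  product, and each tail satisfies \<open>n * P(Z j > sqrt n / b j) \<longlonglongrightarrow> (b
  j)\<^sup>2\<close>.\<close>

lemma max_linear_tail_limit:
  fixes Z :: "nat \<Rightarrow> 'a \<Rightarrow> real" and b :: "nat \<Rightarrow> real"
  assumes "prob_space M" and Z: "standardized_innovations M d Z"
    and d: "1 \<le> d" and b: "\<And>j. j \<in> {1..d} \<Longrightarrow> 0 \<le> b j"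
  shows "(\<lambda>n. real n * measure M {w \<in> space M. \<exists>j\<in>{1..d}. sqrt n < b j * Z j w})
    \<longlonglongrightarrow> (\<Sum>j\<in>{1..d}. (b j)\<^sup>2)"
proof -
  interpret prob_space M by fact
  have indep: "indep_vars (\<lambda>_. borel) Z {1..d}"
    using Z by (simp add: standardized_innovations_def)
  have Z_meas [measurable]: "Z j \<in> borel_measurable M" if "j \<in> {1..d}" for j
    using indep that by (auto simp: indep_vars_def)
  define p where "p j n = prob {w \<in> space M. sqrt (real n) < b j * Z j w}" for j n
  have sets: "{w \<in> space M. sqrt (real n) < b j * Z j w} \<in> events" if "j \<in> {1..d}" for j n
    using Z_meas[OF that] by measurable
  have lim: "(\<lambda>n. real n * p j n) \<longlonglongrightarrow> (b j)\<^sup>2" if j: "j \<in> {1..d}" for j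
  proof (cases "b j = 0")
    \<comment> \<open>The threshold \<open>1 / b j\<close> is meaningless here, but the event
      \<open>sqrt n < 0\<close> is empty.\<close>
    case True
    then show ?thesis by (simp add: p_def not_less)
  next
    case False
    with b[OF j] have bj: "0 < b j" by simp
    have "(\<lambda>n. real n * measure M {w \<in> space M. Z j w / sqrt n > 1 / b j})
        \<longlonglongrightarrow> 1 / (1 / b j)\<^sup>2"
      using Z j bj by (simp add: standardized_innovations_def)
    moreover have "real n * measure M {w \<in> space M. Z j w / sqrt n > 1 / b j} = real n * p j n"
      for n
      \<comment> \<open>At \<open>n = 0\<close> the two events may differ, since division by zero
        yields 0; the factor \<open>real n\<close> hides this.\<close>
      using bj by (cases "n = 0") (simp_all add: p_def field_simps)
    ultimately show ?thesis by (simp add: power_divide)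
  qed
  have "prob {w \<in> space M. \<exists>j\<in>{1..d}. sqrt n < b j * Z j w} = 1 - (\<Prod>j\<in>{1..d}. 1 - p j n)"
    for n :: nat
  proof -
    define U where "U j = {z. b j * z \<le> sqrt n}" for j
    have U: "U j \<in> sets borel" for j unfolding U_def by measurable
    have cU: "Z j -` U j \<inter> space M = space M - {w \<in> space M. sqrt n < b j * Z j w}" for j
      by (auto simp: U_def)
    have "prob (\<Inter>j\<in>{1..d}. Z j -` U j \<inter> space M) = (\<Prod>j\<in>{1..d}. prob (Z j -` U j \<inter> space M))"
      using d U by (intro indep_varsD[OF indep]) auto
    also have "\<dots> = (\<Prod>j\<in>{1..d}. 1 - p j n)"
      unfolding cU p_def by (intro prod.cong refl prob_compl sets)
    also have "(\<Inter>j\<in>{1..d}. Z j -` U j \<inter> space M)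
        = space M - {w \<in> space M. \<exists>j\<in>{1..d}. sqrt n < b j * Z j w}"
      using d by (force simp: U_def not_less)
    also have "prob \<dots> = 1 - prob {w \<in> space M. \<exists>j\<in>{1..d}. sqrt n < b j * Z j w}"
    proof (rule prob_compl)
      have "{w \<in> space M. \<exists>j\<in>{1..d}. sqrt n < b j * Z j w}
          = (\<Union>j\<in>{1..d}. {w \<in> space M. sqrt n < b j * Z j w})" by auto
      then show "{w \<in> space M. \<exists>j\<in>{1..d}. sqrt n < b j * Z j w} \<in> events"
        using sets by (metis (no_types, lifting) finite_atLeastAtMost sets.finite_UN)
    qed
    finally show ?thesis by simp
  qed
  then show ?thesis
    using one_minus_prod_limit[OF _ lim, of "{1..d}"] by simp
qed

text \<open>Parents have larger labels than their children, so the induction runs from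
  \<open>d\<close> downwards. The recursion holds at every point of the space, whereas the
  max-linear representation requires nonnegative innovations.\<close>

lemma recursive_ML_vector_measurable:
  assumes wo: "well_ordered_dag d E" and ml: "recursive_ML_vector M d E c Z X"
    and Z: "\<And>i. i \<in> {1..d} \<Longrightarrow> Z i \<in> borel_measurable M" and i: "i \<in> {1..d}"
  shows "X i \<in> borel_measurable M"
  using i
proof (induction "d - i" arbitrary: i rule: less_induct)
  case less
  have E: "E \<subseteq> {1..d} \<times> {1..d}"
    using wo by (simp add: well_ordered_dag_def dag_on_def)
  have fin: "finite (parents E i)"
    by (rule finite_subset[of _ "{1..d}"]) (use E in \<open>auto simp: parents_def\<close>)
  have par: "X k \<in> borel_measurable M" and ki: "k \<noteq> i" if "k \<in> parents E i" for k
  proof -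
    have "k \<in> {1..d}" "i < k"
      using that E well_ordered_trancl[OF wo, of k i] by (auto simp: parents_def)
    then show "X k \<in> borel_measurable M" "k \<noteq> i" using less by auto
  qed
  \<comment> \<open>The innovation term is stored at index \<open>i\<close>, which is free because
    \<open>i\<close> is not its own parent. The recursion thus becomes a maximum over one finite
    index set.\<close>
  define Y where "Y k w = (if k = i then c i i * Z i w else c i k * X k w)" for k w
  have "(\<lambda>w. Max ((\<lambda>k. Y k w) ` insert i (parents E i))) \<in> borel_measurable M"
    using fin
  proof (intro borel_measurable_Max)
    fix k assume "k \<in> insert i (parents E i)"
    then show "Y k \<in> borel_measurable M"
      unfolding Y_def using Z[OF less.prems] par by (cases "k = i") auto
  qed auto
  moreover have "X i w = Max ((\<lambda>k. Y k w) ` insert i (parents E i))" if "w \<in> space M" for w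
  proof -
    have "(\<lambda>k. Y k w) ` insert i (parents E i)
        = insert (c i i * Z i w) ((\<lambda>k. c i k * X k w) ` parents E i)"
      unfolding image_insert using ki
      by (intro arg_cong2[of _ _ _ _ insert] image_cong) (auto simp: Y_def)
    with ml less.prems that show ?thesis
      by (simp only: recursive_ML_vector_def)
  qed
  ultimately show ?case by (simp cong: measurable_cong)
qed

text \<open>Where the innovations are nonnegative, the two maxima can be exchanged: the partial
  maximum exceeds a level iff some \<open>b k * Z k\<close> does, with \<open>b k\<close> the
  largest coefficient of column \<open>k\<close> among the rows in \<open>h\<close>.\<close>

lemma sq_scaling_partial_max:
  assumes M: "prob_space M" and d: "1 \<le> d" and wo: "well_ordered_dag d E"
    and pos: "positive_weights d E c" and ml: "recursive_ML_vector M d E c Z X"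
    and Z: "standardized_innovations M d Z" and h: "h \<subseteq> {1..d}" "h \<noteq> {}"
  shows "sq_scaling M (partial_max X h)
    = (\<Sum>k\<in>{1..d}. (Max ((\<lambda>i. ml_coeff E c i k) ` h))\<^sup>2)"
proof -
  interpret prob_space M by fact
  let ?a = "ml_coeff E c"
  define b where "b k = Max ((\<lambda>i. ?a i k) ` h)" for k
  have fin: "finite h" using h finite_subset by blast
  have b_ge: "?a i k \<le> b k" if "i \<in> h" for i k
    using fin that by (auto simp: b_def)
  have b_in: "\<exists>i\<in>h. b k = ?a i k" for k
  proof -
    have "b k \<in> (\<lambda>i. ?a i k) ` h"
      unfolding b_def using fin h(2) by (intro Max_in) auto
    then show ?thesis by blast
  qed
  have b_nonneg: "0 \<le> b k" for k
    using b_in[of k] ml_coeff_nonneg[OF wo pos] h(1) by fastforce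
  have RV: "RV2 M d Z" using Z by (simp add: standardized_innovations_def)
  have Z_meas: "Z i \<in> borel_measurable M" if "i \<in> {1..d}" for i
    using RV that by (simp add: RV2_def)
  have Z_nonneg: "AE w in M. \<forall>i\<in>{1..d}. 0 \<le> Z i w"
    using RV by (intro AE_finite_allI) (auto simp: RV2_def)
  have X_meas: "X i \<in> borel_measurable M" if "i \<in> h" for i
    using recursive_ML_vector_measurable[OF wo ml Z_meas] that h(1) by blast
  have iff: "t < partial_max X h w \<longleftrightarrow> (\<exists>k\<in>{1..d}. t < b k * Z k w)"
    if w: "w \<in> space M" and nn: "\<forall>i\<in>{1..d}. 0 \<le> Z i w" for w t
  proof -
    have "t < partial_max X h w \<longleftrightarrow> (\<exists>i\<in>h. t < X i w)"
      using fin h(2) by (simp add: partial_max_def Max_gr_iff)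
    also have "\<dots> \<longleftrightarrow> (\<exists>i\<in>h. \<exists>k\<in>{1..d}. t < ?a i k * Z k w)"
    proof (rule bex_cong[OF refl])
      fix i assume "i \<in> h"
      then have X: "X i w = Max ((\<lambda>k. ?a i k * Z k w) ` {1..d})"
        using recursive_ML_vector_representation[OF wo pos ml _ w nn] h(1) by blast
      show "t < X i w \<longleftrightarrow> (\<exists>k\<in>{1..d}. t < ?a i k * Z k w)"
        unfolding X using d by (subst Max_gr_iff) auto
    qed
    also have "\<dots> \<longleftrightarrow> (\<exists>k\<in>{1..d}. t < b k * Z k w)"
    proof
      assume "\<exists>i\<in>h. \<exists>k\<in>{1..d}. t < ?a i k * Z k w"
      then obtain i k where "i \<in> h" "k \<in> {1..d}" "t < ?a i k * Z k w" by blast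
      moreover from this have "?a i k * Z k w \<le> b k * Z k w"
        using b_ge nn by (intro mult_right_mono) auto
      ultimately show "\<exists>k\<in>{1..d}. t < b k * Z k w" by (meson less_le_trans)
    next
      assume "\<exists>k\<in>{1..d}. t < b k * Z k w"
      then show "\<exists>i\<in>h. \<exists>k\<in>{1..d}. t < ?a i k * Z k w" using b_in by metis
    qed
    finally show ?thesis .
  qed
  have max_meas: "partial_max X h \<in> borel_measurable M"
    unfolding partial_max_def using fin h(2) X_meas by (intro borel_measurable_Max) auto
  have "measure M {w \<in> space M. sqrt n < partial_max X h w}
      = measure M {w \<in> space M. \<exists>k\<in>{1..d}. sqrt n < b k * Z k w}" for n :: nat
  \<comment> \<open>The events agree only almost surely, since \<open>RV2\<close> gives
    nonnegativity only almost everywhere.\<close>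
  proof (rule finite_measure_eq_AE)
    show "AE w in M. (w \<in> {w \<in> space M. sqrt n < partial_max X h w})
        = (w \<in> {w \<in> space M. \<exists>k\<in>{1..d}. sqrt n < b k * Z k w})"
      using Z_nonneg by eventually_elim (use iff in blast)
    show "{w \<in> space M. sqrt n < partial_max X h w} \<in> events"
      using max_meas by measurable
    show "{w \<in> space M. \<exists>k\<in>{1..d}. sqrt n < b k * Z k w} \<in> events"
      using Z_meas by measurable
  qed
  then show ?thesis
    using limI[OF max_linear_tail_limit[OF M Z d b_nonneg]]
    by (simp add: sq_scaling_def b_def)
qed

text \<open>In a column \<open>k \<le> j\<close> the rows beyond \<open>j\<close> vanish by
  triangularity, so row \<open>i\<close> gives the maximum. For \<open>k > j\<close> row
  \<open>k\<close> itself belongs to the index set, and its diagonal entry dominates the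
  column.\<close>

lemma sq_scaling_standardized:
  assumes M: "prob_space M" and d: "1 \<le> d" and wo: "well_ordered_dag d E"
    and pos: "positive_weights d E c" and ml: "recursive_ML_vector M d E c Z X"
    and Z: "standardized_innovations M d Z" and std: "standardized d (ml_coeff E c)"
    and ij: "1 \<le> i" "i \<le> j" "j \<le> d"
  shows "sq_scaling M (partial_max X ({i} \<union> {j<..d}))
    = (\<Sum>k\<in>{1..j}. (ml_coeff E c i k)\<^sup>2) + (\<Sum>k\<in>{j<..d}. (ml_coeff E c k k)\<^sup>2)"
proof -
  let ?a = "ml_coeff E c" and ?h = "{i} \<union> {j<..d}"
  have h: "?h \<subseteq> {1..d}" using ij by auto
  have "sq_scaling M (partial_max X ?h) = (\<Sum>k\<in>{1..d}. (Max ((\<lambda>m. ?a m k) ` ?h))\<^sup>2)"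
    using h by (intro sq_scaling_partial_max[OF M d wo pos ml Z]) auto
  also have "\<dots> = (\<Sum>k\<in>{1..j} \<union> {j<..d}. (Max ((\<lambda>m. ?a m k) ` ?h))\<^sup>2)"
    using ij by (intro sum.cong) auto
  also have "\<dots> = (\<Sum>k\<in>{1..j}. (Max ((\<lambda>m. ?a m k) ` ?h))\<^sup>2)
      + (\<Sum>k\<in>{j<..d}. (Max ((\<lambda>m. ?a m k) ` ?h))\<^sup>2)"
    by (intro sum.union_disjoint) auto
  also have "(\<Sum>k\<in>{1..j}. (Max ((\<lambda>m. ?a m k) ` ?h))\<^sup>2) = (\<Sum>k\<in>{1..j}. (?a i k)\<^sup>2)"
  proof (intro sum.cong refl arg_cong[of _ _ "\<lambda>x. x\<^sup>2"] Max_eqI)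
    fix k y assume "k \<in> {1..j}" "y \<in> (\<lambda>m. ?a m k) ` ?h"
    then show "y \<le> ?a i k"
      using ml_coeff_upper_triangular[OF wo, of k] ml_coeff_nonneg[OF wo pos, of i k] ij by auto
  qed auto
  also have "(\<Sum>k\<in>{j<..d}. (Max ((\<lambda>m. ?a m k) ` ?h))\<^sup>2) = (\<Sum>k\<in>{j<..d}. (?a k k)\<^sup>2)"
  proof (intro sum.cong refl arg_cong[of _ _ "\<lambda>x. x\<^sup>2"] Max_eqI)
    fix k y assume "k \<in> {j<..d}" "y \<in> (\<lambda>m. ?a m k) ` ?h"
    then show "y \<le> ?a k k"
      using ml_coeff_le_diag[OF wo pos std] h by auto
  qed auto
  finally show ?thesis .
qed


section \<open>Positions in the triangular vectors\<close>

text \<open>The common ordering of the entries of \<open>S_M_vec\<close> and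
  \<open>A_sq_vec\<close>. Both vectors become images of this list, so that positions can be traded
  for index pairs.\<close>

definition tri_pairs :: "nat \<Rightarrow> (nat \<times> nat) list" where
  "tri_pairs d = concat (map (\<lambda>i. map (Pair i) [i..<Suc d]) [1..<Suc d])"

lemma set_tri_pairs: "set (tri_pairs d) = {(i, j). 1 \<le> i \<and> i \<le> j \<and> j \<le> d}"
  by (auto simp: tri_pairs_def image_iff simp del: upt_Suc)

lemma concat_map_tri_pairs:
  "concat (map (\<lambda>i. map (f i) [i..<Suc d]) [1..<Suc d]) = map (\<lambda>(i, j). f i j) (tri_pairs d)"
  by (simp add: tri_pairs_def map_concat comp_def del: upt_Suc)

lemma distinct_tri_pairs: "distinct (tri_pairs d)"
  unfolding tri_pairs_def
proof (rule distinct_concat)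
  have "i = i'" if "map (Pair i) [i..<Suc d] = map (Pair i') [i'..<Suc d]"
    and "i \<in> {1..<Suc d}" "i' \<in> {1..<Suc d}" for i i'
  proof -
    have "hd (map (Pair k) [k..<Suc d]) = (k, k)" if "k \<in> {1..<Suc d}" for k
      using that by (simp add: hd_map del: upt_Suc)
    with that show ?thesis by (metis prod.inject)
  qed
  then show "distinct (map (\<lambda>i. map (Pair i) [i..<Suc d]) [1..<Suc d])"
    by (simp add: distinct_map inj_on_def del: upt_Suc)
qed (auto simp: distinct_map inj_on_def simp del: upt_Suc)

lemma length_tri_pairs: "length (tri_pairs d) = d * (d + 1) div 2"
proof -
  have "length (tri_pairs d) = (\<Sum>i=1..<Suc d. Suc d - i)"
    by (simp add: tri_pairs_def length_concat comp_def interv_sum_list_conv_sum_set_nat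
        del: upt_Suc sum.op_ivl_Suc)
  \<comment> \<open>The block lengths decrease from \<open>d\<close> to 1; reversing their order
    gives the sum of the first \<open>d\<close> positive integers.\<close>
  also have "\<dots> = (\<Sum>i=1..<Suc d. Suc d - (Suc d + 1 - Suc i))"
    by (rule sum.atLeastLessThan_rev)
  also have "\<dots> = \<Sum>{1..<Suc d}"
    by (intro sum.cong) auto
  also have "\<dots> = d * (d + 1) div 2"
    by (subst Sum_Ico_nat) (simp add: mult.commute)
  finally show ?thesis .
qed

text \<open>Block \<open>k\<close> has length \<open>Suc d - k\<close>, so the sum counts the
  entries before block \<open>i\<close>, and \<open>j - i\<close> is the offset inside that
  block.\<close>

lemma pos_index_eq:
  assumes "1 \<le> i" "i \<le> j" "j \<le> d"
  shows "pos_index d i j = Suc ((\<Sum>k=1..<i. Suc d - k) + (j - i))"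
proof -
  have "i \<le> Suc d \<Longrightarrow> (\<Sum>k=0..<i. d - k) + i = Suc d + (\<Sum>k=1..<i. Suc d - k)"
    using assms(1)
  proof (induction i rule: nat_induct_at_least)
    case (Suc n)
    then show ?case by simp
  qed simp
  with assms show ?thesis by (simp add: pos_index_def)
qed

lemma tri_pairs_nth_pos_index:
  assumes "1 \<le> i" "i \<le> j" "j \<le> d"
  shows "pos_index d i j - 1 < length (tri_pairs d)"
    and "tri_pairs d ! (pos_index d i j - 1) = (i, j)"
proof -
  let ?f = "\<lambda>i. map (Pair i) [i..<Suc d]"
  have "[1..<Suc d] = [1..<i] @ i # [Suc i..<Suc d]"
    using assms by (metis le_SucI le_add_diff_inverse le_imp_less_Suc le_trans
        upt_add_eq_append upt_conv_Cons)
  then have split: "tri_pairs d = concat (map ?f [1..<i]) @ ?f i @ concat (map ?f [Suc i..<Suc d])"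
    by (simp add: tri_pairs_def del: upt_Suc)
  have len: "length (concat (map ?f [1..<i])) = (\<Sum>k=1..<i. Suc d - k)"
    by (simp add: length_concat comp_def interv_sum_list_conv_sum_set_nat del: upt_Suc)
  have idx: "pos_index d i j - 1 = length (concat (map ?f [1..<i])) + (j - i)"
    unfolding len pos_index_eq[OF assms] by simp
  show "pos_index d i j - 1 < length (tri_pairs d)"
    unfolding idx split using assms by (simp del: upt_Suc)
  show "tri_pairs d ! (pos_index d i j - 1) = (i, j)"
    unfolding idx split nth_append_length_plus using assms
    by (simp add: nth_append Suc_diff_le less_Suc_eq_le diff_le_mono del: upt_Suc)
qed

lemma pos_index_tri_pairs:
  assumes "u < length (tri_pairs d)" "tri_pairs d ! u = (i, j)"
  shows "pos_index d i j = Suc u"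
proof -
  have "(i, j) \<in> set (tri_pairs d)" using assms by (metis nth_mem)
  then have ij: "1 \<le> i" "i \<le> j" "j \<le> d" by (auto simp: set_tri_pairs)
  have "pos_index d i j - 1 = u"
    using tri_pairs_nth_pos_index[OF ij] assms distinct_tri_pairs nth_eq_iff_index_eq by metis
  then show ?thesis using pos_index_eq[OF ij] by simp
qed

lemma pos_index_inject:
  assumes "1 \<le> i" "i \<le> j" "j \<le> d" "1 \<le> i'" "i' \<le> j'" "j' \<le> d"
  shows "pos_index d i j = pos_index d i' j' \<longleftrightarrow> i = i' \<and> j = j'"
  using tri_pairs_nth_pos_index(2)[OF assms(1-3)] tri_pairs_nth_pos_index(2)[OF assms(4-6)]
  by (metis prod.inject)


section \<open>The linear system\<close>

text \<open>The cases \<open>i = j\<close>, \<open>i < j < d\<close> and \<open>j = d\<close> merge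
  into two families valid up to column \<open>d\<close>, and injectivity of the positions decodes
  them into pairs.\<close>

lemma T_plus_iff:
  assumes "1 \<le> i" "i \<le> j" "j \<le> d" "1 \<le> i'" "i' \<le> j'" "j' \<le> d"
  shows "(pos_index d i j, pos_index d i' j') \<in> T_plus d
    \<longleftrightarrow> (i', j') = (i, j) \<or> i < j \<and> (i', j') = (j, j)"
proof -
  have "T_plus d = {(pos_index d i j, pos_index d i j) | i j. 1 \<le> i \<and> i \<le> j \<and> j \<le> d}
      \<union> {(pos_index d i j, pos_index d j j) | i j. 1 \<le> i \<and> i < j \<and> j \<le> d}"
    if "1 \<le> d"
    using that unfolding T_plus_def Let_def
    by (auto simp: le_less)
  with assms show ?thesis by (auto simp: pos_index_inject)
qed

text \<open>The entry at \<open>(i + 1, i + 1)\<close> of a diagonal row is the case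
  \<open>i = j\<close> of the entry at \<open>(j + 1, j + 1)\<close>; only the latter is missing
  when \<open>j = d\<close>.\<close>

lemma T_minus_iff:
  assumes "1 \<le> i" "i \<le> j" "j \<le> d" "1 \<le> i'" "i' \<le> j'" "j' \<le> d"
  shows "(pos_index d i j, pos_index d i' j') \<in> T_minus d
    \<longleftrightarrow> j < d \<and> (i', j') = (j + 1, j + 1) \<or> i < j \<and> (i', j') = (i, j - 1)"
proof -
  have "T_minus d
      = {(pos_index d i j, pos_index d (j + 1) (j + 1)) | i j. 1 \<le> i \<and> i \<le> j \<and> j < d}
      \<union> {(pos_index d i j, pos_index d i (j - 1)) | i j. 1 \<le> i \<and> i < j \<and> j \<le> d}"
    unfolding T_minus_def Let_def by (auto simp: le_less)
  with assms show ?thesis by (auto simp: pos_index_inject)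
qed

lemma T_mat_mult_nth:
  assumes u: "u < length (tri_pairs d)" "tri_pairs d ! u = (i, j)"
  shows "(T_mat d *\<^sub>v vec_of_list (map f (tri_pairs d))) $ u
    = f (i, j) + of_bool (i < j) * f (j, j) - of_bool (j < d) * f (j + 1, j + 1)
      - of_bool (i < j) * f (i, j - 1)"
proof -
  let ?Q = "set (tri_pairs d)"
  \<comment> \<open>The row of \<open>T_mat\<close> as a sum of indicators. This agrees with the
    nested conditionals because the pairs whose conditions hold are distinct. The conjunct
    \<open>True\<close> gives all four terms the shape expected by \<open>pick\<close>.\<close>
  define t :: "nat \<times> nat \<Rightarrow> real" where
    "t q = of_bool (True \<and> q = (i, j)) + of_bool (i < j \<and> q = (j, j))
      - of_bool (j < d \<and> q = (j + 1, j + 1)) - of_bool (i < j \<and> q = (i, j - 1))" for q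
  have "(i, j) \<in> ?Q" using u by (metis nth_mem)
  then have ij: "1 \<le> i" "i \<le> j" "j \<le> d" by (auto simp: set_tri_pairs)
  have entry: "T_mat d $$ (u, v) = t (tri_pairs d ! v)" if v: "v < length (tri_pairs d)" for v
  proof -
    obtain i' j' where q: "tri_pairs d ! v = (i', j')" by force
    then have "(i', j') \<in> ?Q" using v by (metis nth_mem)
    then have ij': "1 \<le> i'" "i' \<le> j'" "j' \<le> d" by (auto simp: set_tri_pairs)
    have "T_mat d $$ (u, v) = (if (pos_index d i j, pos_index d i' j') \<in> T_plus d then 1
      else if (pos_index d i j, pos_index d i' j') \<in> T_minus d then - 1 else 0)"
      using u v pos_index_tri_pairs[OF u] pos_index_tri_pairs[OF v q]
      by (simp add: T_mat_def length_tri_pairs)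
    also have "\<dots> = t (i', j')"
      using ij unfolding T_plus_iff[OF ij ij'] T_minus_iff[OF ij ij'] t_def by auto
    finally show ?thesis by (simp add: q)
  qed
  \<comment> \<open>Membership of \<open>x\<close> is required only under \<open>P\<close>, since
    \<open>(j + 1, j + 1)\<close> leaves the index set when \<open>j = d\<close>.\<close>
  have pick: "(\<Sum>q\<in>?Q. of_bool (P \<and> q = x) * f q) = of_bool P * f x" if "P \<Longrightarrow> x \<in> ?Q" for P x
    using that by (cases P) (simp_all add: of_bool_def if_distrib[of "\<lambda>a. a * _"] cong: if_cong)
  have "(T_mat d *\<^sub>v vec_of_list (map f (tri_pairs d))) $ u
      = (\<Sum>v\<in>{..<length (tri_pairs d)}. T_mat d $$ (u, v) * f (tri_pairs d ! v))"
    using u by (simp add: T_mat_def scalar_prod_def length_tri_pairs vec_of_list_index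
        atLeast0LessThan)
  also have "\<dots> = (\<Sum>v\<in>{..<length (tri_pairs d)}. t (tri_pairs d ! v) * f (tri_pairs d ! v))"
    by (intro sum.cong) (auto simp: entry)
  also have "\<dots> = (\<Sum>q\<in>?Q. t q * f q)"
    using bij_betw_nth[OF distinct_tri_pairs refl refl] by (rule sum.reindex_bij_betw)
  also have "\<dots> = of_bool True * f (i, j) + of_bool (i < j) * f (j, j)
      - of_bool (j < d) * f (j + 1, j + 1) - of_bool (i < j) * f (i, j - 1)"
    unfolding t_def ring_distribs sum.distrib sum_subtractf
    by (subst (1 2 3 4) pick) (use ij in \<open>auto simp: set_tri_pairs\<close>)
  finally show ?thesis by simp
qed

theorem theorem1:
  fixes M :: "'a measure" and d :: nat and E :: "(nat \<times> nat) set"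
    and c :: "nat \<Rightarrow> nat \<Rightarrow> real" and Z X :: "nat \<Rightarrow> 'a \<Rightarrow> real"
  assumes "prob_space M"
    and "1 \<le> d"
    and "well_ordered_dag d E"
    and "positive_weights d E c"
    and "innovations M d Z"
    and "recursive_ML_vector M d E c Z X"
    and "standardized_innovations M d Z"
    and "standardized d (ml_coeff E c)"
  shows "A_sq_vec d (ml_coeff E c) = T_mat d *\<^sub>v S_M_vec M d X"
proof -
  let ?a = "ml_coeff E c"
  define s where "s = (\<lambda>(i, j). sq_scaling M (partial_max X ({i} \<union> {j<..d})))"
  have s: "s (i, j) = (\<Sum>k\<in>{1..j}. (?a i k)\<^sup>2) + (\<Sum>k\<in>{j<..d}. (?a k k)\<^sup>2)"
    if "1 \<le> i" "i \<le> j" "j \<le> d" for i j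
    using sq_scaling_standardized[OF assms(1-4,6-8) that] by (simp add: s_def)
  have row: "(\<Sum>k\<in>{1..j}. (?a i k)\<^sup>2) = (\<Sum>k\<in>{1..<j}. (?a i k)\<^sup>2) + (?a i j)\<^sup>2"
    if "1 \<le> j" for i j
    using that by (simp add: sum.last_plus add.commute)
  have row_diag: "(\<Sum>k\<in>{1..<i}. (?a i k)\<^sup>2) = 0" for i
    using ml_coeff_upper_triangular[OF assms(3)] by (intro sum.neutral) auto
  have s_diag: "s (j, j) = (?a j j)\<^sup>2 + (\<Sum>k\<in>{j<..d}. (?a k k)\<^sup>2)"
    if "1 \<le> j" "j \<le> d" for j
    using that by (simp only: s row row_diag le_refl add_0)
  have diag: "s (j, j) = (\<Sum>k\<in>{j..d}. (?a k k)\<^sup>2)" if "1 \<le> j" "j \<le> d" for j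
    using that by (simp add: s_diag sum.head)
  \<comment> \<open>For \<open>i < j\<close>, the difference \<open>s (i, j) - s (i, j - 1)\<close>
    is \<open>(?a i j)\<^sup>2 - (?a j j)\<^sup>2\<close>, and the difference of consecutive
    diagonal values restores \<open>(?a j j)\<^sup>2\<close>. For \<open>i = j\<close> the diagonal
    difference alone remains.\<close>
  have solve: "s (i, j) + of_bool (i < j) * s (j, j) - of_bool (j < d) * s (j + 1, j + 1)
      - of_bool (i < j) * s (i, j - 1) = (?a i j)\<^sup>2" if ij: "1 \<le> i" "i \<le> j" "j \<le> d" for i j
  proof -
    \<comment> \<open>For \<open>j = d\<close> both sides are 0, which covers the last column
      together with the others.\<close>
    have next_diag: "of_bool (j < d) * s (j + 1, j + 1) = (\<Sum>k\<in>{j<..d}. (?a k k)\<^sup>2)"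
      using ij by (cases "j < d") (auto simp: diag intro!: sum.cong)
    show ?thesis
    proof (cases "i = j")
      case True
      with ij show ?thesis unfolding next_diag by (simp add: s_diag)
    next
      case False
      with ij have j: "1 \<le> j" and "{1..j - 1} = {1..<j}" "{j - 1<..d} = {j..d}" by auto
      with False ij row[OF j, of i] show ?thesis
        unfolding next_diag by (simp add: s[of i] diag)
    qed
  qed
  have S: "S_M_vec M d X = vec_of_list (map s (tri_pairs d))"
    unfolding S_M_vec_def s_def by (simp only: concat_map_tri_pairs)
  have A: "A_sq_vec d ?a = vec_of_list (map (\<lambda>(i, j). (?a i j)\<^sup>2) (tri_pairs d))"
    unfolding A_sq_vec_def by (simp only: concat_map_tri_pairs)
  show ?thesis
  proof (rule eq_vecI)
    show "dim_vec (A_sq_vec d ?a) = dim_vec (T_mat d *\<^sub>v S_M_vec M d X)"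
      by (simp add: A T_mat_def length_tri_pairs)
    fix u assume "u < dim_vec (T_mat d *\<^sub>v S_M_vec M d X)"
    then have u: "u < length (tri_pairs d)" by (simp add: T_mat_def length_tri_pairs)
    obtain i j where q: "tri_pairs d ! u = (i, j)" by force
    then have "(i, j) \<in> set (tri_pairs d)" using u by (metis nth_mem)
    then have "(T_mat d *\<^sub>v S_M_vec M d X) $ u = (?a i j)\<^sup>2"
      unfolding S T_mat_mult_nth[OF u q] by (intro solve) (auto simp: set_tri_pairs)
    with u q show "A_sq_vec d ?a $ u = (T_mat d *\<^sub>v S_M_vec M d X) $ u"
      by (simp add: A vec_of_list_index del: vec_of_list_map)
  qed
qed

end
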